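(* There exists an absolute constant $C>0$ such that for every integer $N\ge 2$, $$\delta(N)\ \le\ C\,N^{1/2}(\log N)^{-1/4}.$$
   Context: For a finite set $P\subset\mathbb{R}^2$, $\Delta(P)$ denotes the maximal cardinality of a subset $Q\subset P$ such that all the $\binom{|Q|}{2}$ pairwise Euclidean distances between elements of $Q$ are distinct (that is, distinct unordered pairs of distinct points of $Q$ determine distinct distances). For a positive integer $N$, $\delta(N)$ denotes the minimum of $\Delta(P)$ over all $N$-element sets $P\subset\mathbb{R}^2$. *)

theory Defs
  imports "HOL-Analysis.Analysis"
begin

definition distinct_distances :: "(real^2) set \<Rightarrow> bool" where
  "distinct_distances Q \<longleftrightarrow>
     (\<forall>a\<in>Q. \<forall>b\<in>Q. \<forall>c\<in>Q. \<forall>d\<in>Q.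
        a \<noteq> b \<longrightarrow> c \<noteq> d \<longrightarrow> {a, b} \<noteq> {c, d} \<longrightarrow> dist a b \<noteq> dist c d)"

text \<open>The \<open>Max\<close> is only meaningful for finite \<open>P\<close>; \<open>delta\<close> only uses such sets.\<close>

definition Delta :: "(real^2) set \<Rightarrow> nat" where
  "Delta P = Max {card Q | Q. Q \<subseteq> P \<and> distinct_distances Q}"

definition delta :: "nat \<Rightarrow> nat" where
  "delta N = Min {Delta P | P. finite P \<and> card P = N}"

text \<open>The maximum and the minimum range over finite nonempty sets of natural numbers,
  so both are attained. For the minimum this holds although there are infinitely many sets
  \<open>P\<close>, because \<open>Delta P \<le> card P\<close>.\<close>

lemma Delta_set_finite_nonempty:
  assumes "finite P"
  shows "finite {card Q | Q. Q \<subseteq> P \<and> distinct_distances Q}"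
    and "{card Q | Q. Q \<subseteq> P \<and> distinct_distances Q} \<noteq> {}"
proof -
  have "{card Q | Q. Q \<subseteq> P \<and> distinct_distances Q} \<subseteq> card ` Pow P"
    by auto
  then show "finite {card Q | Q. Q \<subseteq> P \<and> distinct_distances Q}"
    using assms by (meson finite_Pow_iff finite_imageI finite_subset)
  have "distinct_distances {}"
    by (simp add: distinct_distances_def)
  then show "{card Q | Q. Q \<subseteq> P \<and> distinct_distances Q} \<noteq> {}"
    by blast
qed

lemma Delta_le_card:
  assumes "finite P"
  shows "Delta P \<le> card P"
  using Delta_set_finite_nonempty[OF assms] assms
  unfolding Delta_def by (subst Max_le_iff) (auto intro: card_mono)

lemma delta_set_finite_nonempty:
  shows "finite {Delta P | P. finite P \<and> card P = N}"
    and "{Delta P | P. finite P \<and> card P = N} \<noteq> {}"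
proof -
  have "{Delta P | P. finite P \<and> card P = N} \<subseteq> {..N}"
    using Delta_le_card by auto
  then show "finite {Delta P | P. finite P \<and> card P = N}"
    by (rule finite_subset) simp
  have "infinite (UNIV :: (real^2) set)"
    using finite_imp_bounded not_bounded_UNIV by blast
  then obtain P :: "(real^2) set" where "finite P" "card P = N"
    using infinite_arbitrarily_large by blast
  then show "{Delta P | P. finite P \<and> card P = N} \<noteq> {}"
    by blast
qed

end

theory Submission
  imports Defs "HOL-Number_Theory.Number_Theory"
begin

text \<open>
  The points are taken from a square grid with about \<open>N\<close> points: all its squared distances are
  sums of two squares of size \<open>O(N)\<close>, so a subset with \<open>q\<close> points and distinct distances satisfies
  \<open>q choose 2 \<le> B(O(N))\<close>, where \<open>B(x)\<close> counts the sums of two squares up to \<open>x\<close>. It remains to show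
  Landau's upper bound \<open>B(x) = O(x / sqrt (ln x))\<close>.

  Let \<open>S\<close> be the set of all \<open>u * v\<^sup>2\<close> where \<open>u\<close> has no divisor \<open>3 mod 4\<close>; it contains the sums of two
  squares. Writing \<open>ln n\<close> as a sum of the von Mangoldt function over divisors and using that \<open>S\<close> is
  closed under the corresponding quotients, Chebyshev's bound gives
  \<open>S(x) * ln x = O(x * T(x))\<close> for the number \<open>S(x)\<close> of elements of \<open>S\<close> up to \<open>x\<close> and the sum
  \<open>T(x)\<close> of their reciprocals.
  Up to a constant, \<open>T(x)\<close> is the same sum over products of primes \<open>1 mod 4\<close>, and the square of the
  latter is at most the sum over \<open>n \<le> x\<^sup>2\<close> of \<open>(\<Sum>d | d dvd n. chi d) / n\<close> with the nontrivial
  character \<open>chi\<close> modulo 4, which is \<open>O(ln x)\<close>.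
\<close>

section \<open>Divisor sums and Chebyshev's bound\<close>

lemma sum_divisors_swap:
  fixes f :: "nat \<Rightarrow> nat \<Rightarrow> real"
  shows "(\<Sum>n\<in>{1..N}. \<Sum>d | d dvd n. f d (n div d)) = (\<Sum>d\<in>{1..N}. \<Sum>e\<in>{1..N div d}. f d e)"
proof -
  have "(\<Sum>n\<in>{1..N}. \<Sum>d | d dvd n. f d (n div d)) =
      (\<Sum>(n,d)\<in>(SIGMA n:{1..N}. {d. d dvd n}). f d (n div d))"
    by (subst sum.Sigma) auto
  also have "\<dots> = (\<Sum>(d,e)\<in>(SIGMA d:{1..N}. {1..N div d}). f d e)"
  proof (rule sum.reindex_bij_witness[where i = "\<lambda>(d,e). (d*e, d)" and j = "\<lambda>(n,d). (d, n div d)"],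
      goal_cases)
    case (2 a)
    then obtain n d where a: "a = (n, d)" "1 \<le> n" "n \<le> N" "d dvd n" by auto
    then have "d \<ge> 1" "d \<le> n" by (auto simp: Suc_le_eq dvd_imp_le intro: Nat.gr0I)
    moreover from this have "n div d \<ge> 1" by (simp add: Suc_le_eq div_greater_zero_iff)
    moreover have "n div d \<le> N div d" using a by (simp add: div_le_mono)
    ultimately show ?case using a by simp
  next
    case (4 a) then show ?case
      by (auto simp: less_eq_div_iff_mult_less_eq mult.commute)
  qed auto
  also have "\<dots> = (\<Sum>d\<in>{1..N}. \<Sum>e\<in>{1..N div d}. f d e)"
    by (subst sum.Sigma) auto
  finally show ?thesis .
qed

definition chebyshev_psi :: "nat \<Rightarrow> real" where
  "chebyshev_psi n = (\<Sum>d\<in>{1..n}. mangoldt d)"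

text \<open>The common range \<open>{1..N}\<close> lets the factorials of a binomial coefficient be
  combined termwise; \<open>n div d = 0\<close> for \<open>d > n\<close>.\<close>

lemma ln_fact_eq_sum_mangoldt:
  assumes "n \<le> N"
  shows "ln (fact n) = (\<Sum>d\<in>{1..N}. mangoldt d * real (n div d))"
proof -
  have "ln (fact n) = ln (\<Prod>m\<in>{1..n}. real m)"
    by (simp add: fact_prod)
  also have "\<dots> = (\<Sum>m\<in>{1..n}. ln (real m))"
    by (rule ln_prod) auto
  also have "\<dots> = (\<Sum>m\<in>{1..n}. \<Sum>d | d dvd m. mangoldt d)"
    by (intro sum.cong refl) (subst mangoldt_sum, auto)
  also have "\<dots> = (\<Sum>d\<in>{1..n}. mangoldt d * real (n div d))"
    using sum_divisors_swap[of "\<lambda>d e. mangoldt d" n] by (simp add: mult.commute)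
  also have "\<dots> = (\<Sum>d\<in>{1..N}. mangoldt d * real (n div d))"
    using assms by (intro sum.mono_neutral_left) auto
  finally show ?thesis .
qed

text \<open>Expanding \<open>ln (n choose k)\<close> through factorials gives
  \<open>mangoldt d\<close> a nonnegative coefficient, which is at least 1 when
  \<open>k < d \<le> n\<close>; and \<open>n choose k \<le> 2 ^ n\<close>.\<close>

lemma chebyshev_psi_diff_le:
  assumes "k \<le> n" "n \<le> 2 * k"
  shows "chebyshev_psi n - chebyshev_psi k \<le> real n * ln 2"
proof -
  have fl: "real (k div d) + real ((n - k) div d) \<le> real (n div d)" for d
  proof -
    have "k div d + (n - k) div d \<le> (k + (n - k)) div d"
      by (subst div_add1_eq) simp
    then show ?thesis using assms by (simp flip: of_nat_add)
  qed
  have "chebyshev_psi n - chebyshev_psi k = (\<Sum>d\<in>{k<..n}. mangoldt d)"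
  proof -
    have "{1..n} = {1..k} \<union> {k<..n}" using assms by auto
    then have "chebyshev_psi n = chebyshev_psi k + (\<Sum>d\<in>{k<..n}. mangoldt d)"
      unfolding chebyshev_psi_def by (simp add: ivl_disj_int sum.union_disjoint)
    then show ?thesis by simp
  qed
  also have "\<dots> \<le> (\<Sum>d\<in>{k<..n}. mangoldt d * (real (n div d) - real (k div d) - real ((n - k) div d)))"
  proof (rule sum_mono)
    fix d assume d: "d \<in> {k<..n}"
    then have "n div d \<ge> 1" by (simp add: Suc_le_eq div_greater_zero_iff)
    \<comment> \<open>Here \<open>n \<le> 2 * k\<close> enters: it gives
      \<open>n - k \<le> k < d\<close>.\<close>
    moreover have "k div d = 0" "(n - k) div d = 0" using d assms by auto
    ultimately show "mangoldt d \<le> mangoldt d * (real (n div d) - real (k div d) - real ((n - k) div d))"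
      using mult_left_mono[OF _ mangoldt_nonneg[of d], of 1 "real (n div d)"] by simp
  qed
  also have "\<dots> \<le> (\<Sum>d\<in>{1..n}. mangoldt d * (real (n div d) - real (k div d) - real ((n - k) div d)))"
  proof (intro sum_mono2)
    fix d assume "d \<in> {1..n} - {k<..n}"
    show "0 \<le> mangoldt d * (real (n div d) - real (k div d) - real ((n - k) div d))"
      using fl[of d] by (intro mult_nonneg_nonneg mangoldt_nonneg) simp
  qed auto
  also have "\<dots> = ln (fact n) - ln (fact k) - ln (fact (n - k))"
    using assms by (simp add: ln_fact_eq_sum_mangoldt[of _ n] sum_subtractf right_diff_distrib)
  also have "\<dots> = ln (real (n choose k))"
    using assms by (simp add: binomial_fact ln_div ln_mult)
  also have "\<dots> \<le> ln (2 ^ n)"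
  proof -
    have "n choose k \<le> 2 ^ n" by (rule binomial_le_pow2)
    moreover have "n choose k > 0" using assms by simp
    ultimately have "real (n choose k) \<le> real (2 ^ n)" "real (n choose k) > 0" by (simp_all only: of_nat_le_iff of_nat_0_less_iff)
    then show ?thesis by simp
  qed
  also have "\<dots> = real n * ln 2" by (simp add: ln_realpow)
  finally show ?thesis .
qed

lemma chebyshev_psi_le: "chebyshev_psi n \<le> 4 * real n"
proof (induction n rule: less_induct)
  case (less n)
  show ?case
  proof (cases "n \<le> 1")
    case True
    then have "n = 0 \<or> n = 1" by auto
    then show ?thesis by (auto simp: chebyshev_psi_def)
  next
    case False
    \<comment> \<open>Rounding up ensures \<open>n \<le> 2 * k\<close>; then
      \<open>4 * k + n \<le> 3 * n + 2 \<le> 4 * n\<close> as \<open>n \<ge> 2\<close>.\<close>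
    define k where "k = (n + 1) div 2"
    have k: "k < n" "n \<le> 2 * k" "2 * k \<le> n + 1" using False by (auto simp: k_def)
    have "chebyshev_psi n \<le> chebyshev_psi k + real n * ln 2" using chebyshev_psi_diff_le[of k n] k by simp
    also have "chebyshev_psi k \<le> 4 * real k" using less k by simp
    also have "real n * ln 2 \<le> real n * 1" using ln2_le_25_over_36 by (intro mult_left_mono) auto
    finally show ?thesis using k False by linarith
  qed
qed

section \<open>The nontrivial character modulo 4\<close>

definition chi :: "nat \<Rightarrow> real" where
  "chi d = (if d mod 4 = 1 then 1 else if d mod 4 = 3 then -1 else 0)"

lemma chi_1 [simp]: "chi (Suc 0) = 1"
  by (simp add: chi_def)

lemma chi_mult: "chi (a * b) = chi a * chi b"
proof -
  have "(a * b) mod 4 = ((a mod 4) * (b mod 4)) mod 4" by (simp add: mod_mult_eq)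
  moreover have "a mod 4 = 0 \<or> a mod 4 = 1 \<or> a mod 4 = 2 \<or> a mod 4 = 3" by presburger
  moreover have "b mod 4 = 0 \<or> b mod 4 = 1 \<or> b mod 4 = 2 \<or> b mod 4 = 3" by presburger
  ultimately show ?thesis unfolding chi_def by (elim disjE) simp_all
qed

lemma chi_power: "chi (a ^ k) = chi a ^ k"
  by (induction k) (simp_all add: chi_mult)

text \<open>Signs alternate along the odd numbers, so each negative term pays for the next positive
  one.\<close>

lemma sum_chi_antimono_le:
  fixes g :: "nat \<Rightarrow> real"
  assumes anti: "\<And>d. d \<ge> 1 \<Longrightarrow> g (Suc d) \<le> g d" and nonneg: "\<And>d. g d \<ge> 0"
  shows "(\<Sum>d\<in>{1..N}. chi d * g d) \<le> g 1"
proof -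
  \<comment> \<open>The strengthened bound reserves \<open>g (Suc N)\<close> exactly while the next
    nonzero value of \<open>chi\<close> is 1.\<close>
  have "(\<Sum>d\<in>{1..N}. chi d * g d) \<le> g 1 - (if N mod 4 = 0 \<or> N mod 4 = 3 then g (Suc N) else 0)"
  proof (induction N)
    case (Suc N)
    have "N mod 4 = 0 \<or> N mod 4 = 1 \<or> N mod 4 = 2 \<or> N mod 4 = 3" by presburger
    then show ?case using Suc anti[of "Suc N"]
      by (elim disjE) (simp_all add: chi_def mod_Suc)
  qed simp
  then show ?thesis using nonneg[of "Suc N"] by (auto split: if_splits)
qed

text \<open>Used to factor divisor sums at one prime: the exponent \<open>i\<close> is recovered as
  the multiplicity of \<open>p\<close>, since \<open>p\<close> does not divide
  \<open>e\<close>.\<close>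

lemma divisors_prime_power_mult:
  fixes p m :: nat
  assumes "prime p" "\<not> p dvd m"
  shows "bij_betw (\<lambda>(i,e). p ^ i * e) ({..k} \<times> {e. e dvd m}) {d. d dvd p ^ k * m}"
proof (rule bij_betw_imageI)
  show "inj_on (\<lambda>(i,e). p ^ i * e) ({..k} \<times> {e. e dvd m})"
  proof (rule inj_onI, clarsimp)
    fix i e j f assume *: "e dvd m" "f dvd m" "p ^ i * e = p ^ j * f"
    have mult: "multiplicity p (p ^ l * c) = l" if "c dvd m" for l c
    proof -
      have "\<not> p dvd c" using that assms dvd_trans by blast
      moreover from this have "c \<noteq> 0" by (metis dvd_0_right)
      ultimately show ?thesis using assms
        by (simp add: prime_elem_multiplicity_mult_distrib not_dvd_imp_multiplicity_0)
    qed
    have "i = j" using mult[OF *(1), of i] mult[OF *(2), of j] *(3) by simp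
    then show "i = j \<and> e = f" using * assms by auto
  qed
  show "(\<lambda>(i,e). p ^ i * e) ` ({..k} \<times> {e. e dvd m}) = {d. d dvd p ^ k * m}"
  proof (intro equalityI subsetI)
    fix d assume "d \<in> {d. d dvd p ^ k * m}"
    then obtain b c where "d = b * c" "b dvd p ^ k" "c dvd m" using division_decomp[of d] by blast
    then show "d \<in> (\<lambda>(i,e). p ^ i * e) ` ({..k} \<times> {e. e dvd m})"
      using divides_primepow_nat[OF assms(1)] by force
  qed (auto intro: mult_dvd_mono le_imp_power_dvd)
qed

text \<open>Splitting off the full power of a prime \<open>p\<close> contributes the factor
  \<open>1 + chi p + ... + chi p ^ k\<close>. It is nonnegative because \<open>chi p\<close> is 0, 1
  or -1, and for -1 it is 1 or 0.\<close>

lemma sum_chi_divisors_nonneg: "n > 0 \<Longrightarrow> (\<Sum>d | d dvd n. chi d) \<ge> 0"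
proof (induction n rule: less_induct)
  case (less n)
  show ?case
  proof (cases "n = 1")
    case False
    then obtain p where p: "prime p" "p dvd n" using prime_factor_nat by blast
    have pu: "\<not> is_unit p" using p by auto
    obtain m where m: "n = p ^ multiplicity p n * m" "\<not> p dvd m"
      using multiplicity_decompose'[of n p] less.prems pu by blast
    define k where "k = multiplicity p n"
    have "k > 0" unfolding k_def using p less.prems by (simp add: prime_multiplicity_gt_zero_iff)
    have "m > 0" using m less.prems by (metis gr0I mult_0_right)
    have "p ^ k > 1" using \<open>k > 0\<close> p(1) by (metis one_less_power prime_gt_1_nat)
    then have "m < n" using m(1) \<open>m > 0\<close> unfolding k_def by (metis mult_less_cancel2 nat_mult_1)
    have "(\<Sum>d | d dvd n. chi d) = (\<Sum>(i,e)\<in>{..k} \<times> {e. e dvd m}. chi (p ^ i * e))"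
      using sum.reindex_bij_betw[OF divisors_prime_power_mult[OF p(1) m(2), of k], of chi] m(1)
      by (simp add: case_prod_unfold k_def)
    also have "\<dots> = (\<Sum>i\<le>k. \<Sum>e | e dvd m. chi p ^ i * chi e)"
      by (simp add: sum.cartesian_product chi_mult chi_power)
    also have "\<dots> = (\<Sum>i\<le>k. chi p ^ i) * (\<Sum>e | e dvd m. chi e)"
      by (simp add: sum_product)
    also have "\<dots> \<ge> 0"
    proof (rule mult_nonneg_nonneg)
      show "(\<Sum>e | e dvd m. chi e) \<ge> 0" using less.IH \<open>m < n\<close> \<open>m > 0\<close> by simp
      have "(\<Sum>i\<le>k. (-1::real) ^ i) \<ge> 0" for k
      proof -
        have "(\<Sum>i\<le>k. (-1::real) ^ i) = (if even k then 1 else 0)" by (induction k) auto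
        then show ?thesis by simp
      qed
      moreover have "chi p \<ge> 0 \<or> chi p = -1" by (simp add: chi_def)
      ultimately show "(\<Sum>i\<le>k. chi p ^ i) \<ge> 0" by (elim disjE) (simp_all add: sum_nonneg)
    qed
    finally show ?thesis .
  qed simp
qed

section \<open>Sums of reciprocals\<close>

definition recip_sum :: "nat set \<Rightarrow> nat \<Rightarrow> real" where
  "recip_sum S x = (\<Sum>m\<in>S \<inter> {1..x}. 1 / real m)"

text \<open>The products of primes 1 modulo 4. Quantifying over all divisors gives
  \<open>chi d = 1\<close> for each of them directly and rules out 0.\<close>

definition divisors_1_mod_4 :: "nat set" where
  "divisors_1_mod_4 = {u. \<forall>d. d dvd u \<longrightarrow> d mod 4 = 1}"

definition no_divisor_3_mod_4 :: "nat set" where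
  "no_divisor_3_mod_4 = {u. u > 0 \<and> (\<forall>d. d dvd u \<longrightarrow> d mod 4 \<noteq> 3)}"

text \<open>
  A superset of the positive sums of two squares. Unlike that set, it is visibly closed under
  dividing \<open>u * v\<^sup>2\<close> by a divisor of \<open>u\<close> or by the square of a divisor of \<open>v\<close>.
\<close>

definition square_multiples :: "nat set" where
  "square_multiples = {u * v\<^sup>2 | u v. u \<in> no_divisor_3_mod_4 \<and> v > 0}"

lemma recip_sum_nonneg: "recip_sum S x \<ge> 0"
  unfolding recip_sum_def by (intro sum_nonneg) auto

lemma divisors_1_mod_4_mult:
  assumes "u \<in> divisors_1_mod_4" "v \<in> divisors_1_mod_4"
  shows "u * v \<in> divisors_1_mod_4"
  unfolding divisors_1_mod_4_def
proof clarify
  fix d assume "d dvd u * v"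
  then obtain b c where "d = b * c" "b dvd u" "c dvd v" using division_decomp[of d] by blast
  then show "d mod 4 = 1" using assms by (simp add: divisors_1_mod_4_def mod_mult_eq[symmetric])
qed

lemma no_divisor_3_mod_4_dvd:
  assumes "u \<in> no_divisor_3_mod_4" "d dvd u"
  shows "d \<in> no_divisor_3_mod_4"
  using assms unfolding no_divisor_3_mod_4_def by (auto intro: dvd_trans Nat.gr0I)

lemma odd_no_divisor_3_mod_4:
  assumes "u \<in> no_divisor_3_mod_4" "odd u"
  shows "u \<in> divisors_1_mod_4"
  unfolding divisors_1_mod_4_def
proof clarify
  fix d assume d: "d dvd u"
  then have "odd d" using assms dvd_trans by blast
  moreover have "d mod 4 \<noteq> 3" using d assms by (auto simp: no_divisor_3_mod_4_def)
  ultimately show "d mod 4 = 1" by presburger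
qed

text \<open>
  Expanding the square counts each \<open>n\<close> at most as often as it has divisors, and for \<open>n\<close> composed
  of primes \<open>1 mod 4\<close> the number of divisors is the sum of \<open>chi\<close> over them. That sum is nonnegative
  for every \<open>n\<close>, so the range of \<open>n\<close> can be extended; after exchanging the summations the outer
  sum alternates with decreasing terms and is bounded by its first term.
\<close>

lemma recip_sum_1_mod_4_square_le: "(recip_sum divisors_1_mod_4 x)\<^sup>2 \<le> harm (x\<^sup>2)"
proof -
  let ?U = "divisors_1_mod_4 \<inter> {1..x}" and ?N = "x\<^sup>2"
  have "(recip_sum divisors_1_mod_4 x)\<^sup>2 = (\<Sum>(u,v)\<in>?U \<times> ?U. 1 / real (u * v))"
    by (simp add: recip_sum_def power2_eq_square sum_product sum.cartesian_product)
  also have "\<dots> = (\<Sum>(n,d)\<in>(\<lambda>(u,v). (u * v, u)) ` (?U \<times> ?U). 1 / real n)"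
    by (subst sum.reindex) (auto simp: inj_on_def case_prod_unfold)
  also have "\<dots> \<le> (\<Sum>(n,d)\<in>(SIGMA n:divisors_1_mod_4 \<inter> {1..?N}. {d. d dvd n}). 1 / real n)"
  proof (intro sum_mono2)
    show "(\<lambda>(u,v). (u * v, u)) ` (?U \<times> ?U) \<subseteq> (SIGMA n:divisors_1_mod_4 \<inter> {1..?N}. {d. d dvd n})"
      by (auto simp: divisors_1_mod_4_mult power2_eq_square mult_le_mono Suc_le_eq)
  qed auto
  also have "\<dots> = (\<Sum>n\<in>divisors_1_mod_4 \<inter> {1..?N}. \<Sum>d | d dvd n. 1 / real n)"
    by (subst sum.Sigma) auto
  also have "\<dots> = (\<Sum>n\<in>divisors_1_mod_4 \<inter> {1..?N}. (\<Sum>d | d dvd n. chi d) / real n)"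
    unfolding sum_divide_distrib
    by (intro sum.cong refl) (auto simp: divisors_1_mod_4_def chi_def)
  also have "\<dots> \<le> (\<Sum>n\<in>{1..?N}. (\<Sum>d | d dvd n. chi d) / real n)"
    by (intro sum_mono2) (auto intro!: divide_nonneg_nonneg sum_chi_divisors_nonneg)
  also have "\<dots> = (\<Sum>n\<in>{1..?N}. \<Sum>d | d dvd n. chi d / real (d * (n div d)))"
    unfolding sum_divide_distrib by (intro sum.cong refl) auto
  also have "\<dots> = (\<Sum>d\<in>{1..?N}. \<Sum>e\<in>{1..?N div d}. chi d / real (d * e))"
    by (rule sum_divisors_swap)
  also have "\<dots> = (\<Sum>d\<in>{1..?N}. chi d * (harm (?N div d) / real d))"
    by (simp add: harm_def sum_distrib_left sum_divide_distrib field_simps)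
  also have "\<dots> \<le> harm (?N div 1) / real 1"
    by (rule sum_chi_antimono_le) (auto intro!: frac_le harm_mono div_le_mono2 divide_nonneg_nonneg harm_nonneg)
  finally show ?thesis by simp
qed

text \<open>An odd element lies in \<^const>\<open>divisors_1_mod_4\<close>; halving the even ones recovers half of the left side.\<close>

lemma recip_sum_no_3_mod_4_le:
  "recip_sum no_divisor_3_mod_4 x \<le> 2 * recip_sum divisors_1_mod_4 x"
proof -
  let ?G = "no_divisor_3_mod_4 \<inter> {1..x}"
  have "recip_sum no_divisor_3_mod_4 x = (\<Sum>m\<in>{m\<in>?G. odd m}. 1 / real m) + (\<Sum>m\<in>{m\<in>?G. even m}. 1 / real m)"
    unfolding recip_sum_def by (subst sum.union_disjoint[symmetric]) (auto intro: sum.cong)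
  also have "(\<Sum>m\<in>{m\<in>?G. odd m}. 1 / real m) \<le> recip_sum divisors_1_mod_4 x"
    unfolding recip_sum_def using odd_no_divisor_3_mod_4 by (intro sum_mono2) auto
  also have "(\<Sum>m\<in>{m\<in>?G. even m}. 1 / real m) \<le> (\<Sum>m\<in>(\<lambda>m. 2 * m) ` ?G. 1 / real m)"
  proof (intro sum_mono2 subsetI)
    fix m assume m: "m \<in> {m\<in>?G. even m}"
    then have "m div 2 \<in> ?G"
      by (auto intro!: no_divisor_3_mod_4_dvd[of m] simp: div_dvd_iff_mult elim!: evenE)
    moreover have "m = 2 * (m div 2)" using m by simp
    ultimately show "m \<in> (\<lambda>m. 2 * m) ` ?G" by blast
  qed auto
  also have "\<dots> = recip_sum no_divisor_3_mod_4 x / 2"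
    unfolding recip_sum_def by (subst sum.reindex) (auto simp: inj_on_def sum_divide_distrib mult.commute)
  finally show ?thesis by simp
qed

lemma sum_inverse_squares_le: "(\<Sum>v\<in>{1..x}. 1 / (real v)\<^sup>2) \<le> 2"
proof -
  \<comment> \<open>The subtracted \<open>1 / real (Suc n)\<close> makes the induction
    telescope.\<close>
  have *: "(\<Sum>v\<in>{1..Suc n}. 1 / (real v)\<^sup>2) \<le> 2 - 1 / real (Suc n)" for n
  proof (induction n)
    case (Suc n)
    define y where "y = real (Suc n)"
    have "y > 0" by (simp add: y_def)
    have "1 / (y + 1)\<^sup>2 \<le> 1 / (y * (y + 1))"
      using \<open>y > 0\<close> by (intro frac_le) (auto simp: power2_eq_square)
    also have "\<dots> = 1 / y - 1 / (y + 1)"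
      using \<open>y > 0\<close> by (simp add: field_simps)
    also have "y + 1 = real (Suc (Suc n))" by (simp add: y_def)
    finally show ?case using Suc by (simp add: y_def)
  qed simp
  show ?thesis
  proof (cases x)
    case (Suc n)
    have "1 / real (Suc n) \<ge> 0" by simp
    then show ?thesis using *[of n] unfolding Suc by linarith
  qed simp
qed

text \<open>The sum over all pairs \<open>(u, v)\<close> factors, and the sum of
  \<open>1 / v\<^sup>2\<close> is at most 2. Repeated values of \<open>u * v\<^sup>2\<close> only
  increase the sum over pairs.\<close>

lemma recip_sum_square_multiples_le:
  "recip_sum square_multiples x \<le> 2 * recip_sum no_divisor_3_mod_4 x"
proof -
  let ?G = "no_divisor_3_mod_4 \<inter> {1..x}"
  have "recip_sum square_multiples x \<le> (\<Sum>m\<in>(\<lambda>(u,v). u * v\<^sup>2) ` (?G \<times> {1..x}). 1 / real m)"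
    unfolding recip_sum_def
  proof (intro sum_mono2 subsetI)
    fix m assume "m \<in> square_multiples \<inter> {1..x}"
    then obtain u v where uv: "m = u * v\<^sup>2" "u \<in> no_divisor_3_mod_4" "v > 0" "m \<le> x" "m > 0"
      by (auto simp: square_multiples_def)
    then have "u dvd m" "v dvd m" by (auto simp: power2_eq_square)
    then have "u \<le> m" "v \<le> m" using uv(5) by (blast intro: dvd_imp_le)+
    then have "u \<le> x" "v \<le> x" using uv(4) by simp_all
    then show "m \<in> (\<lambda>(u,v). u * v\<^sup>2) ` (?G \<times> {1..x})"
      using uv by (auto intro!: image_eqI[of _ _ "(u, v)"] simp: Suc_le_eq)
  qed auto
  also have "\<dots> \<le> (\<Sum>(u,v)\<in>?G \<times> {1..x}. 1 / real (u * v\<^sup>2))"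
    by (rule order.trans[OF sum_image_le]) (auto simp: o_def case_prod_unfold)
  also have "\<dots> = recip_sum no_divisor_3_mod_4 x * (\<Sum>v\<in>{1..x}. 1 / (real v)\<^sup>2)"
    by (simp add: recip_sum_def sum_product sum.cartesian_product)
  also have "\<dots> \<le> recip_sum no_divisor_3_mod_4 x * 2"
    by (intro mult_left_mono sum_inverse_squares_le recip_sum_nonneg)
  finally show ?thesis by simp
qed

lemma harm_le_ln: "n > 0 \<Longrightarrow> harm n \<le> 1 + ln (real n)"
proof (induction n rule: nat_induct_non_zero)
  case (Suc n)
  \<comment> \<open>This is \<open>ln t \<le> t - 1\<close> at
    \<open>t = n / (n + 1)\<close>.\<close>
  have "1 / real (Suc n) \<le> ln (real (Suc n)) - ln (real n)"
    using Suc ln_le_minus_one[of "real n / real (Suc n)"] by (simp add: ln_div field_simps)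
  then show ?case using Suc by (simp add: harm_Suc inverse_eq_divide)
qed (simp add: harm_def)

text \<open>The 8 collects a factor 2 for even numbers, a 2 for square factors, and a 2 from
  \<open>1 + 2 * ln x \<le> 4 * ln x\<close>, valid since \<open>ln x \<ge> 1 / 2\<close>.\<close>

lemma recip_sum_square_multiples_le_sqrt_ln:
  assumes "x \<ge> 2"
  shows "recip_sum square_multiples x \<le> 8 * sqrt (ln (real x))"
proof -
  have "ln (real x) \<ge> ln 2" using assms by simp
  then have l: "ln (real x) \<ge> 1 / 2" using ln2_ge_two_thirds by linarith
  have "(recip_sum divisors_1_mod_4 x)\<^sup>2 \<le> 1 + ln (real (x\<^sup>2))"
    using recip_sum_1_mod_4_square_le[of x] harm_le_ln[of "x\<^sup>2"] assms by simp
  also have "\<dots> = 1 + 2 * ln (real x)" using assms by (simp add: ln_realpow)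
  also have "\<dots> \<le> (2 * sqrt (ln (real x)))\<^sup>2" using l by (simp add: power_mult_distrib)
  finally have "recip_sum divisors_1_mod_4 x \<le> 2 * sqrt (ln (real x))"
    by (rule power2_le_imp_le) (use l in auto)
  then show ?thesis
    using recip_sum_no_3_mod_4_le[of x] recip_sum_square_multiples_le[of x] by linarith
qed

section \<open>Landau's bound by logarithmic weights\<close>

text \<open>Here \<open>ln n = ln u + 2 * ln v\<close>, and dividing out a divisor of
  \<open>u\<close>, or the square of a divisor of \<open>v\<close>, stays in the set. The conditions
  mention only \<open>n\<close>, so the bound can be summed without choosing \<open>u\<close> and
  \<open>v\<close>.\<close>

lemma ln_square_multiple_le:
  assumes "n \<in> square_multiples"
  shows "ln (real n) \<le> (\<Sum>d | d dvd n \<and> n div d \<in> square_multiples. mangoldt d)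
    + 2 * (\<Sum>d | d\<^sup>2 dvd n \<and> n div d\<^sup>2 \<in> square_multiples. mangoldt d)"
proof -
  from assms obtain u v where n: "n = u * v\<^sup>2" and u: "u \<in> no_divisor_3_mod_4" and v: "v > 0"
    by (auto simp: square_multiples_def)
  have u0: "u > 0" using u by (auto simp: no_divisor_3_mod_4_def)
  have n0: "n > 0" using n u0 v by simp
  have "ln (real n) = ln (real u) + 2 * ln (real v)"
    using u0 v by (simp add: n ln_mult ln_realpow)
  also have "ln (real u) = (\<Sum>d | d dvd u. mangoldt d)" using u0 by (subst mangoldt_sum) auto
  also have "ln (real v) = (\<Sum>d | d dvd v. mangoldt d)" using v by (subst mangoldt_sum) auto
  also have "(\<Sum>d | d dvd u. mangoldt d :: real) \<le> (\<Sum>d | d dvd n \<and> n div d \<in> square_multiples. mangoldt d)"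
  proof (intro sum_mono2 subsetI)
    show "finite {d. d dvd n \<and> n div d \<in> square_multiples}" using n0 by simp
    fix d assume d: "d \<in> {d. d dvd u}"
    then have "n div d = (u div d) * v\<^sup>2" by (simp add: n dvd_div_mult)
    moreover have "u div d \<in> no_divisor_3_mod_4"
      using d u no_divisor_3_mod_4_dvd[of u "u div d"] by (metis dvd_div_mult_self dvd_triv_left mem_Collect_eq)
    ultimately show "d \<in> {d. d dvd n \<and> n div d \<in> square_multiples}"
      using d v n by (auto simp: square_multiples_def)
  qed (auto intro: mangoldt_nonneg)
  also have "(\<Sum>d | d dvd v. mangoldt d :: real) \<le> (\<Sum>d | d\<^sup>2 dvd n \<and> n div d\<^sup>2 \<in> square_multiples. mangoldt d)"
  proof (intro sum_mono2 subsetI)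
    have "{d. d\<^sup>2 dvd n} \<subseteq> {d. d dvd n}" by (auto simp: power2_eq_square intro: dvd_mult_left)
    then show "finite {d. d\<^sup>2 dvd n \<and> n div d\<^sup>2 \<in> square_multiples}"
      using n0 by (auto intro: finite_subset[of _ "{d. d dvd n}"])
    fix d assume "d \<in> {d. d dvd v}"
    then obtain e where e: "v = d * e" by auto
    then have "d > 0" "e > 0" using v by auto
    moreover from this have "n div d\<^sup>2 = u * e\<^sup>2" by (simp add: n e power_mult_distrib mult_ac)
    ultimately show "d \<in> {d. d\<^sup>2 dvd n \<and> n div d\<^sup>2 \<in> square_multiples}"
      using u e n by (auto simp: square_multiples_def)
  qed (auto intro: mangoldt_nonneg)
  finally show ?thesis by simp
qed

text \<open>Substituting \<open>m = n div h d\<close> gives pairs with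
  \<open>m * d \<le> m * h d \<le> x\<close>. The lemma serves \<open>h d = d\<close> and
  \<open>h d = d\<^sup>2\<close> alike; \<open>h 0 = 0\<close> keeps \<open>d = 0\<close> out
  because 0 divides no positive \<open>n\<close>.\<close>

lemma sum_over_quotients_le:
  fixes h :: "nat \<Rightarrow> nat"
  assumes h0: "h 0 = 0" and h: "\<And>d. h d \<ge> d"
  shows "(\<Sum>n\<in>S \<inter> {1..x}. \<Sum>d | h d dvd n \<and> n div h d \<in> S. mangoldt d) \<le> (\<Sum>m\<in>S \<inter> {1..x}. chebyshev_psi (x div m))"
proof -
  have fin: "finite {d. h d dvd n \<and> n div h d \<in> S}" if "n > 0" for n
  proof (rule finite_subset)
    show "{d. h d dvd n \<and> n div h d \<in> S} \<subseteq> {..n}"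
      using that h by (auto dest!: dvd_imp_le intro: order.trans)
  qed simp
  have "(\<Sum>n\<in>S \<inter> {1..x}. \<Sum>d | h d dvd n \<and> n div h d \<in> S. mangoldt d :: real) =
      (\<Sum>(n,d)\<in>(SIGMA n:S \<inter> {1..x}. {d. h d dvd n \<and> n div h d \<in> S}). mangoldt d)"
    using fin by (subst sum.Sigma) auto
  also have "\<dots> = (\<Sum>(m,d)\<in>(\<lambda>(n,d). (n div h d, d)) ` (SIGMA n:S \<inter> {1..x}. {d. h d dvd n \<and> n div h d \<in> S}). mangoldt d)"
    by (subst sum.reindex) (auto simp: inj_on_def case_prod_unfold elim!: dvdE)
  also have "\<dots> \<le> (\<Sum>(m,d)\<in>(SIGMA m:S \<inter> {1..x}. {1..x div m}). mangoldt d)"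
  proof (intro sum_mono2 subsetI)
    fix z assume "z \<in> (\<lambda>(n,d). (n div h d, d)) ` (SIGMA n:S \<inter> {1..x}. {d. h d dvd n \<and> n div h d \<in> S})"
    then obtain n d where z: "z = (n div h d, d)" "n \<in> S" "1 \<le> n" "n \<le> x" "h d dvd n" "n div h d \<in> S"
      by auto
    define m where "m = n div h d"
    have n: "n = m * h d" using z by (simp add: m_def)
    then have "m > 0" using z by (auto intro: Nat.gr0I)
    have "d > 0" using z h0 by (auto intro: Nat.gr0I)
    have "m \<le> x" using n z h[of d] by (metis dvd_imp_le dvd_triv_left le_trans less_le_trans zero_less_one)
    have "m * d \<le> x" using n z h[of d] by (meson le_trans mult_le_mono2 order_refl)
    then have "d \<le> x div m" using \<open>m > 0\<close> by (simp add: less_eq_div_iff_mult_less_eq mult.commute)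
    then show "z \<in> (SIGMA m:S \<inter> {1..x}. {1..x div m})"
      using z \<open>m > 0\<close> \<open>m \<le> x\<close> \<open>d \<le> x div m\<close> \<open>d > 0\<close> by (simp flip: m_def)
  qed (auto intro: mangoldt_nonneg)
  also have "\<dots> = (\<Sum>m\<in>S \<inter> {1..x}. chebyshev_psi (x div m))"
    unfolding chebyshev_psi_def by (subst sum.Sigma) auto
  finally show ?thesis .
qed

lemma card_square_multiples_le:
  assumes "x \<ge> 2"
  shows "real (card (square_multiples \<inter> {1..x})) \<le> 104 * real x / sqrt (ln (real x))"
proof -
  let ?B = "square_multiples \<inter> {1..x}"
  define T where "T = recip_sum square_multiples x"
  have lpos: "ln (real x) > 0" using assms by simp
  have chebyshev_psi: "(\<Sum>m\<in>?B. chebyshev_psi (x div m)) \<le> 4 * real x * T"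
    unfolding T_def recip_sum_def sum_distrib_left
  proof (rule sum_mono)
    fix m assume "m \<in> ?B"
    have "chebyshev_psi (x div m) \<le> 4 * real (x div m)" by (rule chebyshev_psi_le)
    also have "\<dots> \<le> 4 * (real x / real m)" using of_nat_div_le_of_nat by (intro mult_left_mono) auto
    finally show "chebyshev_psi (x div m) \<le> 4 * real x * (1 / real m)" by simp
  qed
  have q1: "(\<Sum>n\<in>?B. \<Sum>d | d dvd n \<and> n div d \<in> square_multiples. mangoldt d) \<le> (\<Sum>m\<in>?B. chebyshev_psi (x div m))"
    by (rule sum_over_quotients_le) auto
  have q2: "(\<Sum>n\<in>?B. \<Sum>d | d\<^sup>2 dvd n \<and> n div d\<^sup>2 \<in> square_multiples. mangoldt d) \<le> (\<Sum>m\<in>?B. chebyshev_psi (x div m))"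
    by (rule sum_over_quotients_le) (auto simp: power2_eq_square)
  \<comment> \<open>Each element weighs \<open>ln x = ln n + ln (x / n)\<close>; the second part
    costs only \<open>x / n\<close>.\<close>
  have "real (card ?B) * ln (real x) = (\<Sum>n\<in>?B. ln (real n)) + (\<Sum>n\<in>?B. ln (real x / real n))"
    using assms by (subst sum.distrib[symmetric]) (simp add: ln_div)
  also have "(\<Sum>n\<in>?B. ln (real x / real n)) \<le> (\<Sum>n\<in>?B. real x / real n)"
  proof (rule sum_mono)
    fix n assume "n \<in> ?B"
    then have "real x / real n > 0" by simp
    then show "ln (real x / real n) \<le> real x / real n" using ln_le_minus_one[of "real x / real n"] by linarith
  qed
  also have "\<dots> = real x * T" by (simp add: T_def recip_sum_def sum_distrib_left)
  also have "(\<Sum>n\<in>?B. ln (real n)) \<le>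
      (\<Sum>n\<in>?B. (\<Sum>d | d dvd n \<and> n div d \<in> square_multiples. mangoldt d)
        + 2 * (\<Sum>d | d\<^sup>2 dvd n \<and> n div d\<^sup>2 \<in> square_multiples. mangoldt d))"
    by (intro sum_mono ln_square_multiple_le) auto
  also have "\<dots> \<le> (\<Sum>m\<in>?B. chebyshev_psi (x div m)) + 2 * (\<Sum>m\<in>?B. chebyshev_psi (x div m))"
    using q1 q2 by (simp add: sum.distrib flip: sum_distrib_left)
  also have "\<dots> \<le> 12 * real x * T" using chebyshev_psi by linarith
  \<comment> \<open>Three Chebyshev sums of at most \<open>4 * x * T\<close> and one
    \<open>x * T\<close> make 13; the factor 8 in the bound on \<open>T\<close> then yields
    104.\<close>
  finally have "real (card ?B) * ln (real x) \<le> 13 * real x * T" by linarith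
  also have "\<dots> \<le> 13 * real x * (8 * sqrt (ln (real x)))"
    unfolding T_def using recip_sum_square_multiples_le_sqrt_ln[OF assms] by (intro mult_left_mono) auto
  finally have "real (card ?B) * ln (real x) \<le> 104 * real x * sqrt (ln (real x))" by linarith
  moreover have "ln (real x) = sqrt (ln (real x)) * sqrt (ln (real x))" using lpos by simp
  ultimately have "(real (card ?B) * sqrt (ln (real x))) * sqrt (ln (real x)) \<le> (104 * real x) * sqrt (ln (real x))"
    by (simp only: mult.assoc)
  then have "real (card ?B) * sqrt (ln (real x)) \<le> 104 * real x"
    by (rule mult_right_le_imp_le) (use lpos in simp)
  then show ?thesis using lpos by (simp add: pos_le_divide_eq)
qed

section \<open>Sums of two squares\<close>

text \<open>A product is 3 modulo 4 only if one factor is, so splitting off a prime either finds the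
  required one or passes to a smaller cofactor.\<close>

lemma prime_divisor_3_mod_4:
  "d mod 4 = 3 \<Longrightarrow> \<exists>p. prime p \<and> p dvd d \<and> p mod 4 = (3::nat)"
proof (induction d rule: less_induct)
  case (less d)
  have "d \<noteq> 1" "d > 0" using less.prems by (auto intro: Nat.gr0I)
  then obtain p where p: "prime p" "p dvd d" using prime_factor_nat by blast
  then obtain e where d: "d = p * e" by auto
  have "e < d" using d \<open>d > 0\<close> prime_gt_1_nat[OF p(1)] by simp
  have "((p mod 4) * (e mod 4)) mod 4 = 3" using less.prems d by (simp add: mod_mult_eq)
  moreover have "p mod 4 = 0 \<or> p mod 4 = 1 \<or> p mod 4 = 2 \<or> p mod 4 = 3" by presburger
  moreover have "e mod 4 = 0 \<or> e mod 4 = 1 \<or> e mod 4 = 2 \<or> e mod 4 = 3" by presburger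
  ultimately have "p mod 4 = 3 \<or> e mod 4 = 3" by (elim disjE) simp_all
  then show ?case
  proof
    assume "e mod 4 = 3"
    then obtain q where "prime q" "q dvd e" "q mod 4 = 3" using less.IH \<open>e < d\<close> by blast
    then show ?thesis using d by auto
  qed (use p in blast)
qed

text \<open>Otherwise \<open>p\<close> divides neither number. Raising
  \<open>a\<^sup>2 = - b\<^sup>2\<close> modulo \<open>p\<close> to the power
  \<open>(p - 1) div 2\<close>, which is odd, and applying Fermat's theorem gives
  \<open>1 = - 1\<close> modulo \<open>p\<close>.\<close>

lemma prime_3_mod_4_dvd_sum_squares:
  fixes p a b :: nat
  assumes p: "prime p" "p mod 4 = 3" and dvd: "p dvd a\<^sup>2 + b\<^sup>2"
  shows "p dvd a"
proof (rule ccontr)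
  assume a: "\<not> p dvd a"
  then have "\<not> p dvd a\<^sup>2" using p(1) prime_dvd_power by blast
  then have "\<not> p dvd b\<^sup>2" using dvd dvd_add_left_iff by blast
  then have b: "\<not> p dvd b" by (auto simp: power2_eq_square)
  define k where "k = (p - 1) div 2"
  have k: "odd k" "2 * k = p - 1" using p(2) unfolding k_def by presburger+
  have "[int a ^ 2 = - (int b ^ 2)] (mod int p)"
    using dvd by (simp add: cong_iff_dvd_diff flip: of_nat_power of_nat_add)
  then have "[(int a ^ 2) ^ k = (- (int b ^ 2)) ^ k] (mod int p)" by (rule cong_pow)
  then have "[int (a ^ (p - 1)) = - int (b ^ (p - 1))] (mod int p)"
    using k by (simp flip: power_mult)
  moreover have "[int (a ^ (p - 1)) = int 1] (mod int p)"
    unfolding cong_int_iff by (rule fermat_theorem[OF p(1) a])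
  moreover have "[int (b ^ (p - 1)) = int 1] (mod int p)"
    unfolding cong_int_iff by (rule fermat_theorem[OF p(1) b])
  ultimately have "[1 = - 1] (mod int p)"
    by (metis cong_minus_minus_iff cong_sym cong_trans of_nat_1)
  then have "int p dvd 2" by (simp add: cong_iff_dvd_diff)
  then have "p \<le> 2" by (auto dest: zdvd_imp_le)
  then show False using p prime_ge_2_nat[OF p(1)] by auto
qed

text \<open>Descent: a prime 3 modulo 4 dividing the sum divides both \<open>a\<close> and
  \<open>b\<close>, so its square cancels and is absorbed into \<open>v\<close>.\<close>

lemma sum_two_squares_in_square_multiples:
  "a\<^sup>2 + b\<^sup>2 > 0 \<Longrightarrow> a\<^sup>2 + b\<^sup>2 \<in> square_multiples"
proof (induction "a\<^sup>2 + b\<^sup>2" arbitrary: a b rule: less_induct)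
  case less
  show ?case
  proof (cases "a\<^sup>2 + b\<^sup>2 \<in> no_divisor_3_mod_4")
    case True
    moreover have "a\<^sup>2 + b\<^sup>2 = (a\<^sup>2 + b\<^sup>2) * 1\<^sup>2" by simp
    ultimately show ?thesis unfolding square_multiples_def using zero_less_one by blast
  next
    case False
    then obtain d where "d dvd a\<^sup>2 + b\<^sup>2" "d mod 4 = 3"
      using less.prems by (auto simp: no_divisor_3_mod_4_def)
    then obtain p where p: "prime p" "p mod 4 = 3" "p dvd a\<^sup>2 + b\<^sup>2"
      using prime_divisor_3_mod_4 dvd_trans by blast
    then have "p dvd a" "p dvd b"
      using prime_3_mod_4_dvd_sum_squares[of p a b] prime_3_mod_4_dvd_sum_squares[of p b a]
      by (simp_all add: add.commute)
    then obtain a' b' where ab: "a = p * a'" "b = p * b'" by (auto elim!: dvdE)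
    then have eq: "a\<^sup>2 + b\<^sup>2 = (a'\<^sup>2 + b'\<^sup>2) * p\<^sup>2" by (simp add: power_mult_distrib algebra_simps)
    have pos: "a'\<^sup>2 + b'\<^sup>2 > 0" using less.prems eq by (metis gr0I mult_0)
    have "p\<^sup>2 > 1" using prime_gt_1_nat[OF p(1)] by (intro one_less_power) auto
    then have "a'\<^sup>2 + b'\<^sup>2 < a\<^sup>2 + b\<^sup>2" using pos eq by simp
    then have "a'\<^sup>2 + b'\<^sup>2 \<in> square_multiples" using pos by (rule less.hyps)
    then obtain u v where "a'\<^sup>2 + b'\<^sup>2 = u * v\<^sup>2" "u \<in> no_divisor_3_mod_4" "v > 0"
      by (auto simp: square_multiples_def)
    moreover from this have "a\<^sup>2 + b\<^sup>2 = u * (v * p)\<^sup>2" by (simp add: eq power_mult_distrib)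
    moreover have "v * p > 0" using \<open>v > 0\<close> prime_gt_0_nat[OF p(1)] by simp
    ultimately show ?thesis unfolding square_multiples_def by blast
  qed
qed

section \<open>Grid points and their distances\<close>

definition grid_point :: "nat \<times> nat \<Rightarrow> real^2" where
  "grid_point = (\<lambda>(i, j). vector [real i, real j])"

lemma dist_grid_point:
  "(dist (grid_point (i, j)) (grid_point (i', j')))\<^sup>2 = (real i - real i')\<^sup>2 + (real j - real j')\<^sup>2"
  by (simp add: grid_point_def dist_vec_def L2_set_def sum_2 dist_real_def)

lemma inj_grid_point: "inj grid_point"
proof (rule injI, clarify)
  fix i j i' j' assume eq: "grid_point (i, j) = grid_point (i', j')"
  have "grid_point (i, j) $ 1 = grid_point (i', j') $ 1" "grid_point (i, j) $ 2 = grid_point (i', j') $ 2"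
    unfolding eq by simp_all
  then show "i = i' \<and> j = j'" by (simp add: grid_point_def)
qed

lemma dist_grid_in_square_multiples:
  assumes "a \<in> grid_point ` ({..<k} \<times> {..<k})" "b \<in> grid_point ` ({..<k} \<times> {..<k})" "a \<noteq> b"
  shows "(dist a b)\<^sup>2 \<in> real ` (square_multiples \<inter> {1..2 * k\<^sup>2})"
proof -
  obtain i j i' j' where ab: "a = grid_point (i, j)" "b = grid_point (i', j')"
    and k: "i < k" "j < k" "i' < k" "j' < k"
    using assms by auto
  define s t where "s = nat \<bar>int i - int i'\<bar>" and "t = nat \<bar>int j - int j'\<bar>"
  have "real s = \<bar>real i - real i'\<bar>" "real t = \<bar>real j - real j'\<bar>" by (auto simp: s_def t_def)
  then have d: "(dist a b)\<^sup>2 = real (s\<^sup>2 + t\<^sup>2)" by (simp add: ab dist_grid_point)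
  have "(dist a b)\<^sup>2 > 0" using assms(3) by simp
  then have pos: "s\<^sup>2 + t\<^sup>2 > 0" unfolding d by (simp only: of_nat_0_less_iff)
  have "s \<le> k" "t \<le> k" using k by (auto simp: s_def t_def)
  then have "s\<^sup>2 \<le> k\<^sup>2" "t\<^sup>2 \<le> k\<^sup>2" by (simp_all add: power_mono)
  then have "s\<^sup>2 + t\<^sup>2 \<le> 2 * k\<^sup>2" by linarith
  then have "s\<^sup>2 + t\<^sup>2 \<in> square_multiples \<inter> {1..2 * k\<^sup>2}"
    using pos sum_two_squares_in_square_multiples[OF pos] by (simp add: Suc_le_eq)
  then show ?thesis unfolding d by (rule imageI)
qed

text \<open>Distinct distances make the squared distance injective on two-element subsets of
  \<open>Q\<close>.\<close>

lemma distinct_distances_choose_2_le: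
  assumes "finite Q" "distinct_distances Q" "finite D"
    and D: "\<And>a b. a \<in> Q \<Longrightarrow> b \<in> Q \<Longrightarrow> a \<noteq> b \<Longrightarrow> (dist a b)\<^sup>2 \<in> D"
  shows "card Q choose 2 \<le> card D"
proof -
  let ?E = "{s. s \<subseteq> Q \<and> card s = 2}"
  \<comment> \<open>a choice-free way to read off \<open>(dist a b)\<^sup>2\<close> from the unordered pair \<open>{a, b}\<close>\<close>
  define h :: "(real^2) set \<Rightarrow> real" where "h s = (\<Sum>a\<in>s. \<Sum>b\<in>s. (dist a b)\<^sup>2) / 2" for s
  have h: "h {a, b} = (dist a b)\<^sup>2" if "a \<noteq> b" for a b
    using that by (simp add: h_def dist_commute)
  have "card Q choose 2 = card ?E" using assms by (simp add: n_subsets)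
  also have "\<dots> \<le> card D"
  proof (rule card_inj_on_le[of h])
    show "h ` ?E \<subseteq> D" using D by (auto simp: card_2_iff h)
    show "inj_on h ?E"
    proof (rule inj_onI)
      fix s t assume "s \<in> ?E" "t \<in> ?E" "h s = h t"
      then obtain a b c d where s: "s = {a, b}" "a \<noteq> b" "a \<in> Q" "b \<in> Q"
        and t: "t = {c, d}" "c \<noteq> d" "c \<in> Q" "d \<in> Q"
        by (auto simp: card_2_iff)
      then have "dist a b = dist c d" using \<open>h s = h t\<close> by (simp add: h)
      then show "s = t" using s t assms(2) unfolding distinct_distances_def by blast
    qed
  qed fact
  finally show ?thesis .
qed

text \<open>Gives the side of a grid with at least \<open>N\<close> and still O(N) points. Rounding
  up the root adds at most \<open>1 \<le> sqrt N\<close>, so it at most doubles.\<close>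

lemma square_between:
  assumes "N \<ge> 1"
  obtains k :: nat where "N \<le> k\<^sup>2" "k\<^sup>2 \<le> 4 * N"
proof
  define k where "k = nat \<lceil>sqrt (real N)\<rceil>"
  have k: "sqrt (real N) \<le> real k" "real k \<le> sqrt (real N) + 1" by (auto simp: k_def)
  have "sqrt (real N) \<ge> 1" using assms by simp
  then have "real k \<le> 2 * sqrt (real N)" using k by linarith
  then have "(real k)\<^sup>2 \<le> (2 * sqrt (real N))\<^sup>2" by (intro power_mono) auto
  then have "real (k\<^sup>2) \<le> real (4 * N)" by (simp add: power_mult_distrib)
  then show "k\<^sup>2 \<le> 4 * N" by (simp only: of_nat_le_iff)
  have "(sqrt (real N))\<^sup>2 \<le> (real k)\<^sup>2" using k by (intro power_mono) auto
  then have "real N \<le> real (k\<^sup>2)" by simp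
  then show "N \<le> k\<^sup>2" by (simp only: of_nat_le_iff)
qed

lemma delta_le:
  assumes "finite P" "card P = N" "\<And>Q. Q \<subseteq> P \<Longrightarrow> distinct_distances Q \<Longrightarrow> real (card Q) \<le> c"
  shows "real (delta N) \<le> c"
proof -
  have "delta N \<le> Delta P"
    unfolding delta_def using assms by (intro Min_le delta_set_finite_nonempty) auto
  moreover have "Delta P \<in> {card Q | Q. Q \<subseteq> P \<and> distinct_distances Q}"
    unfolding Delta_def by (intro Max_in Delta_set_finite_nonempty assms)
  then have "real (Delta P) \<le> c" using assms(3) by auto
  ultimately show ?thesis by linarith
qed

theorem proposition1p2:
  shows "\<exists>C::real. C > 0 \<and>
    (\<forall>N::nat. N \<ge> 2 \<longrightarrow>
      real (delta N) \<le> C * real N powr (1/2) * ln (real N) powr (- (1/4)))"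
\<comment> \<open>The square \<open>58\<^sup>2 = 3364\<close> exceeds the 3329 that the quadratic
  inequality for \<open>q\<close> produces below.\<close>
proof (intro exI[of _ 58] conjI allI impI)
  fix N :: nat assume N: "N \<ge> 2"
  define M where "M = real N / sqrt (ln (real N))"
  have lpos: "ln (real N) > 0" using N by simp
  have "ln (real N) \<le> (real N)\<^sup>2"
  proof -
    have "real N \<le> (real N)\<^sup>2" using N by (simp add: power2_eq_square)
    then show ?thesis using ln_le_minus_one[of "real N"] N by linarith
  qed
  then have "sqrt (ln (real N)) \<le> real N" by (intro real_le_lsqrt) auto
  then have M1: "M \<ge> 1" using lpos by (simp add: M_def)
  obtain k where k: "N \<le> k\<^sup>2" "k\<^sup>2 \<le> 4 * N" using square_between N by (metis One_nat_def Suc_1 Suc_leD)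
  let ?G = "grid_point ` ({..<k} \<times> {..<k})"
  have "card ?G = k\<^sup>2"
    using inj_grid_point by (simp add: card_image inj_on_subset power2_eq_square)
  then obtain P where P: "P \<subseteq> ?G" "card P = N" "finite P"
    using k(1) obtain_subset_with_card_n by metis
  show "real (delta N) \<le> 58 * real N powr (1/2) * ln (real N) powr (- (1/4))"
  proof (rule delta_le)
    fix Q assume Q: "Q \<subseteq> P" "distinct_distances Q"
    \<comment> \<open>Squared grid distances are at most
      \<open>2 * k\<^sup>2 \<le> 8 * N\<close>.\<close>
    let ?D = "square_multiples \<inter> {1..8 * N}"
    define q where "q = real (card Q)"
    have "card Q choose 2 \<le> card (real ` ?D)"
    proof (rule distinct_distances_choose_2_le)
      show "finite Q" using Q P finite_subset by blast
      fix a b assume "a \<in> Q" "b \<in> Q" "a \<noteq> b"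
      then have "(dist a b)\<^sup>2 \<in> real ` (square_multiples \<inter> {1..2 * k\<^sup>2})"
        using Q P by (intro dist_grid_in_square_multiples) auto
      then show "(dist a b)\<^sup>2 \<in> real ` ?D" using k(2) by auto
    qed (use Q in auto)
    also have "\<dots> = card ?D" by (rule card_image) auto
    finally have "real (card Q choose 2) \<le> real (card ?D)" by simp
    also have "\<dots> \<le> 104 * real (8 * N) / sqrt (ln (real (8 * N)))"
      using N by (intro card_square_multiples_le) auto
    also have "\<dots> \<le> 104 * real (8 * N) / sqrt (ln (real N))"
      using lpos N by (intro divide_left_mono) auto
    also have "\<dots> = 832 * M" by (simp add: M_def)
    finally have "q * (q - 1) / 2 \<le> 832 * M"
      unfolding q_def by (simp add: binomial_gbinomial gbinomial_prod_rev numeral_2_eq_2 mult_ac)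
    \<comment> \<open>With \<open>2 * q \<le> q\<^sup>2 + 1\<close> the bound becomes
      \<open>q\<^sup>2 \<le> 3328 * M + 1\<close>, and \<open>M \<ge> 1\<close> absorbs the
      1.\<close>
    moreover have "(q - 1)\<^sup>2 \<ge> 0" by simp
    ultimately have "q\<^sup>2 \<le> 3364 * M" using M1 by (simp add: power2_eq_square algebra_simps)
    also have "\<dots> = (58 * real N powr (1/2) * ln (real N) powr (- (1/4)))\<^sup>2"
    proof -
      have "(real N powr (1/2))\<^sup>2 = real N" using N by (simp add: powr_half_sqrt)
      moreover have "(ln (real N) powr (- (1/4)))\<^sup>2 = 1 / sqrt (ln (real N))"
        using lpos by (simp add: power2_eq_square powr_half_sqrt powr_minus_divide flip: powr_add)
      ultimately show ?thesis by (simp add: power_mult_distrib M_def)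
    qed
    finally have "q \<le> 58 * real N powr (1/2) * ln (real N) powr (- (1/4))"
      by (rule power2_le_imp_le) simp
    then show "real (card Q) \<le> 58 * real N powr (1/2) * ln (real N) powr (- (1/4))"
      unfolding q_def .
  qed (use P in auto)
qed simp

end
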